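(* Let $R$ be a commutative domain, $\sigma$ an endomorphism of $R$, and $M_R$ an $R$-module. Then $R\oplus_{\sigma}M_R$ is Armendariz if and only if $M_R$ is Armendariz. In particular, if $M_R$ is torsion-free, then $R\oplus_{\sigma}M_R$ is Armendariz.
   Context: All rings are associative with identity and modules are right modules. For a commutative ring $R$, a module $M_R$ and an endomorphism $\sigma$ of $R$, the Nagata extension $R\oplus_{\sigma}M_R$ is the additive group $R\oplus M$ with the (possibly noncommutative) multiplication $(a,m)(b,n)=(ab,\,n\sigma(a)+mb)$ for $a,b\in R$, $m,n\in M$. A module $M$ over a ring $R$ is Armendariz if whenever $m=\sum_{i=0}^{n}m_ix^i\in M[x]$ and $f=\sum_{j=0}^{p}a_jx^j\in R[x]$ satisfy $mf=0$ (where $mf=\sum_{i,j}m_ia_jx^{i+j}$), then $m_ia_j=0$ for all $i,j$. A ring $T$ is Armendariz if the module $T_T$ is Armendariz. For a commutative domain $R$, $M_R$ is torsion-free if $T(M)=\{m\in M : r_R(m)\neq 0\}$ equals $0$, where $r_R(m)=\{a\in R: ma=0\}$. *)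

theory Defs
  imports "HOL-Algebra.UnivPoly"
begin

text \<open>Right modules over a possibly noncommutative ring are carried by the record type of
  \<^theory>\<open>HOL-Algebra.Module\<close>; its field \<^const>\<open>smult\<close> is read as a right action, that is,
  \<open>a \<odot>\<^bsub>M\<^esub> m\<close> stands for \<open>m a\<close>.  Only the order of the factors in \<open>ract_assoc\<close> differs from
  the library's locale.\<close>

locale right_module = R?: ring R + M?: abelian_group M for R (structure) and M (structure) +
  assumes ract_closed:
      "\<lbrakk>a \<in> carrier R; m \<in> carrier M\<rbrakk> \<Longrightarrow> a \<odot>\<^bsub>M\<^esub> m \<in> carrier M"
    and ract_add_scalar:
      "\<lbrakk>a \<in> carrier R; b \<in> carrier R; m \<in> carrier M\<rbrakk> \<Longrightarrow>
        (a \<oplus>\<^bsub>R\<^esub> b) \<odot>\<^bsub>M\<^esub> m = a \<odot>\<^bsub>M\<^esub> m \<oplus>\<^bsub>M\<^esub> b \<odot>\<^bsub>M\<^esub> m"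
    and ract_add_vector:
      "\<lbrakk>a \<in> carrier R; m \<in> carrier M; n \<in> carrier M\<rbrakk> \<Longrightarrow>
        a \<odot>\<^bsub>M\<^esub> (m \<oplus>\<^bsub>M\<^esub> n) = a \<odot>\<^bsub>M\<^esub> m \<oplus>\<^bsub>M\<^esub> a \<odot>\<^bsub>M\<^esub> n"
    and ract_assoc:
      "\<lbrakk>a \<in> carrier R; b \<in> carrier R; m \<in> carrier M\<rbrakk> \<Longrightarrow>
        (a \<otimes>\<^bsub>R\<^esub> b) \<odot>\<^bsub>M\<^esub> m = b \<odot>\<^bsub>M\<^esub> (a \<odot>\<^bsub>M\<^esub> m)"
    and ract_one:
      "m \<in> carrier M \<Longrightarrow> \<one>\<^bsub>R\<^esub> \<odot>\<^bsub>M\<^esub> m = m"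

lemma right_module_iff_module:
  assumes "cring R"
  shows "right_module R M \<longleftrightarrow> module R M"
proof
  assume "right_module R M"
  then interpret right_module R M .
  interpret C: cring R by fact
  show "module R M"
    by (rule moduleI)
       (simp_all add: assms M.abelian_group_axioms ract_closed ract_add_scalar ract_add_vector
          ract_one, metis C.m_comm ract_assoc)
next
  assume "module R M"
  then interpret module R M .
  show "right_module R M"
    by unfold_locales
       (simp_all add: smult_l_distr smult_r_distr, metis R.m_comm smult_assoc1)
qed

text \<open>The regular module \<open>T\<^sub>T\<close>; the multiplication and unit fields of a module record are
  irrelevant.\<close>

definition regular_module :: "('a, 'r) ring_scheme \<Rightarrow> ('a, 'a) module" where
  "regular_module T =
     \<lparr>carrier = carrier T, mult = mult T, one = one T, zero = zero T, add = add T,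
      smult = (\<lambda>a m. m \<otimes>\<^bsub>T\<^esub> a)\<rparr>"

text \<open>The carrier of \<open>M[x]\<close> is \<^term>\<open>up M\<close>, the set of finitely supported coefficient sequences
  in \<open>M\<close>, which uses only the carrier and the zero of \<open>M\<close>; likewise \<^term>\<open>up R\<close> for \<open>R[x]\<close>.\<close>

definition poly_ract ::
  "('a, 'b, 'm) module_scheme \<Rightarrow> (nat \<Rightarrow> 'b) \<Rightarrow> (nat \<Rightarrow> 'a) \<Rightarrow> nat \<Rightarrow> 'b" where
  "poly_ract M m f = (\<lambda>k. \<Oplus>\<^bsub>M\<^esub>i\<in>{..k}. f (k - i) \<odot>\<^bsub>M\<^esub> m i)"

definition armendariz_module ::
  "('a, 'r) ring_scheme \<Rightarrow> ('a, 'b, 'm) module_scheme \<Rightarrow> bool" where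
  "armendariz_module R M \<longleftrightarrow>
     right_module R M \<and>
     (\<forall>m\<in>up M. \<forall>f\<in>up R.
        poly_ract M m f = (\<lambda>k. \<zero>\<^bsub>M\<^esub>) \<longrightarrow> (\<forall>i j. f j \<odot>\<^bsub>M\<^esub> m i = \<zero>\<^bsub>M\<^esub>))"

definition armendariz_ring :: "('a, 'r) ring_scheme \<Rightarrow> bool" where
  "armendariz_ring T \<longleftrightarrow> armendariz_module T (regular_module T)"

lemma right_module_regular_iff: "right_module T (regular_module T) \<longleftrightarrow> ring T"
proof
  assume "right_module T (regular_module T)"
  then show "ring T" by (simp add: right_module_def)
next
  assume "ring T"
  then interpret ring T .
  have "abelian_group (regular_module T)"
  proof (rule abelian_groupI)
    fix x assume "x \<in> carrier (regular_module T)"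
    then show "\<exists>y\<in>carrier (regular_module T).
        y \<oplus>\<^bsub>regular_module T\<^esub> x = \<zero>\<^bsub>regular_module T\<^esub>"
      by (intro bexI[of _ "\<ominus>\<^bsub>T\<^esub> x"]) (auto simp: regular_module_def l_neg)
  qed (auto simp: regular_module_def a_ac)
  then show "right_module T (regular_module T)"
    by (intro right_module.intro right_module_axioms.intro ring_axioms)
       (auto simp: regular_module_def l_distr r_distr m_assoc)
qed

definition nagata ::
  "('a, 'r) ring_scheme \<Rightarrow> ('a \<Rightarrow> 'a) \<Rightarrow> ('a, 'b, 'm) module_scheme \<Rightarrow> ('a \<times> 'b) ring" where
  "nagata R \<sigma> M =
     \<lparr>carrier = carrier R \<times> carrier M,
      mult = (\<lambda>(a, m) (b, n). (a \<otimes>\<^bsub>R\<^esub> b, \<sigma> a \<odot>\<^bsub>M\<^esub> n \<oplus>\<^bsub>M\<^esub> b \<odot>\<^bsub>M\<^esub> m)),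
      one = (\<one>\<^bsub>R\<^esub>, \<zero>\<^bsub>M\<^esub>),
      zero = (\<zero>\<^bsub>R\<^esub>, \<zero>\<^bsub>M\<^esub>),
      add = (\<lambda>(a, m) (b, n). (a \<oplus>\<^bsub>R\<^esub> b, m \<oplus>\<^bsub>M\<^esub> n))\<rparr>"

lemma ring_nagata:
  assumes "cring R" "right_module R M" "\<sigma> \<in> ring_hom R R"
  shows "ring (nagata R \<sigma> M)"
proof -
  interpret module R M using assms right_module_iff_module by blast
  interpret S: ring_hom_cring R R \<sigma>
    by (intro ring_hom_cring.intro ring_hom_cring_axioms.intro assms)
  show ?thesis
  proof (rule ringI)
    show "abelian_group (nagata R \<sigma> M)"
    proof (rule abelian_groupI)
      fix x assume "x \<in> carrier (nagata R \<sigma> M)"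
      then show "\<exists>y\<in>carrier (nagata R \<sigma> M). y \<oplus>\<^bsub>nagata R \<sigma> M\<^esub> x = \<zero>\<^bsub>nagata R \<sigma> M\<^esub>"
        by (intro bexI[of _ "(\<ominus>\<^bsub>R\<^esub> fst x, \<ominus>\<^bsub>M\<^esub> snd x)"])
           (auto simp: nagata_def R.l_neg M.l_neg)
    qed (auto simp: nagata_def R.a_ac M.a_ac)
    show "Group.monoid (nagata R \<sigma> M)"
      by (rule monoidI)
         (auto simp: nagata_def R.m_ac M.a_ac smult_r_distr smult_assoc1 [symmetric])
  qed (auto simp: nagata_def R.l_distr R.r_distr M.a_ac smult_l_distr smult_r_distr)
qed

definition right_annihilator ::
  "('a, 'r) ring_scheme \<Rightarrow> ('a, 'b, 'm) module_scheme \<Rightarrow> 'b \<Rightarrow> 'a set" where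
  "right_annihilator R M m = {a \<in> carrier R. a \<odot>\<^bsub>M\<^esub> m = \<zero>\<^bsub>M\<^esub>}"

definition torsion_set ::
  "('a, 'r) ring_scheme \<Rightarrow> ('a, 'b, 'm) module_scheme \<Rightarrow> 'b set" where
  "torsion_set R M = {m \<in> carrier M. right_annihilator R M m \<noteq> {\<zero>\<^bsub>R\<^esub>}}"

definition torsion_free ::
  "('a, 'r) ring_scheme \<Rightarrow> ('a, 'b, 'm) module_scheme \<Rightarrow> bool" where
  "torsion_free R M \<longleftrightarrow> torsion_set R M = {\<zero>\<^bsub>M\<^esub>}"

end

theory Submission
  imports Defs
begin

text \<open>The product of \<open>(f, m)\<close> and \<open>(g, n)\<close> in \<open>(R \<oplus> M)[x]\<close> is
  \<open>(f g, n \<sigma>(f) + m g)\<close>.  If it vanishes, then \<open>f = 0\<close> or \<open>g = 0\<close> because \<open>R[x]\<close> is a domain,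
  so only one of the two summands \<open>m g\<close> and \<open>n \<sigma>(f)\<close> survives, and to that one the Armendariz
  property of \<open>M\<close> applies.  Conversely, \<open>(0, m) (g, 0) = (0, m g)\<close>.\<close>

text \<open>\<open>finsum\<close> depends only on carrier, addition and zero, which the regular
  module shares with \<open>T\<close>.\<close>

lemma finsum_regular_module [simp]: "finsum (regular_module T) f A = finsum T f A"
  by (simp add: finsum_def finprod_def regular_module_def)

lemma regular_module_simps [simp]:
  "carrier (regular_module T) = carrier T"
  "zero (regular_module T) = zero T"
  "add (regular_module T) = add T"
  "a \<odot>\<^bsub>regular_module T\<^esub> m = m \<otimes>\<^bsub>T\<^esub> a"
  by (simp_all add: regular_module_def)

lemma up_regular_module [simp]: "up (regular_module T) = up T"
  by (simp add: up_def)

lemma up_closed: "p \<in> up R \<Longrightarrow> p i \<in> carrier R"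
  by (auto simp: up_def)

text \<open>Finite support survives because \<open>h\<close> sends zero to zero. This covers the
  coordinate projections, the embeddings of \<open>m\<close> as \<open>(0, m)\<close> and of
  \<open>f\<close> as \<open>(f, 0)\<close>, and the coefficientwise action of
  \<open>\<sigma>\<close>.\<close>

lemma up_map:
  assumes "p \<in> up R" "\<And>a. a \<in> carrier R \<Longrightarrow> h a \<in> carrier S" "h \<zero>\<^bsub>R\<^esub> = \<zero>\<^bsub>S\<^esub>"
  shows "(\<lambda>i. h (p i)) \<in> up S"
proof -
  obtain n where "bound \<zero>\<^bsub>R\<^esub> n p" using assms(1) by (auto simp: up_def)
  then have "bound \<zero>\<^bsub>S\<^esub> n (\<lambda>i. h (p i))"
    using assms(3) by (auto simp: bound_def)
  then show ?thesis using assms by (auto simp: up_def)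
qed

context right_module
begin

lemma ract_zero_vector [simp]: "a \<in> carrier R \<Longrightarrow> a \<odot>\<^bsub>M\<^esub> \<zero>\<^bsub>M\<^esub> = \<zero>\<^bsub>M\<^esub>"
  using ract_add_vector[of a "\<zero>\<^bsub>M\<^esub>" "\<zero>\<^bsub>M\<^esub>"] ract_closed[of a "\<zero>\<^bsub>M\<^esub>"]
  by (simp add: M.add.l_cancel_one')

lemma ract_zero_scalar [simp]: "m \<in> carrier M \<Longrightarrow> \<zero>\<^bsub>R\<^esub> \<odot>\<^bsub>M\<^esub> m = \<zero>\<^bsub>M\<^esub>"
  using ract_add_scalar[of "\<zero>\<^bsub>R\<^esub>" "\<zero>\<^bsub>R\<^esub>" m] ract_closed[of "\<zero>\<^bsub>R\<^esub>" m]
  by (simp add: M.add.l_cancel_one')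

lemma poly_ract_closed:
  assumes "\<And>i. m i \<in> carrier M" "\<And>i. f i \<in> carrier R"
  shows "poly_ract M m f k \<in> carrier M"
  unfolding poly_ract_def using assms by (intro M.finsum_closed) (auto simp: ract_closed)

lemma poly_ract_zero_left:
  assumes "\<And>i. m i = \<zero>\<^bsub>M\<^esub>" "\<And>i. f i \<in> carrier R"
  shows "poly_ract M m f k = \<zero>\<^bsub>M\<^esub>"
  unfolding poly_ract_def using assms by (intro M.add.finprod_one_eqI) auto

lemma poly_ract_zero_right:
  assumes "\<And>i. m i \<in> carrier M" "\<And>i. f i = \<zero>\<^bsub>R\<^esub>"
  shows "poly_ract M m f k = \<zero>\<^bsub>M\<^esub>"
  unfolding poly_ract_def using assms by (intro M.add.finprod_one_eqI) auto

text \<open>The product of the lowest nonzero coefficients is the lowest coefficient of the product.\<close>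

lemma poly_ract_eq_zero_imp:
  assumes ann: "\<And>a m. \<lbrakk>a \<in> carrier R; m \<in> carrier M; a \<odot>\<^bsub>M\<^esub> m = \<zero>\<^bsub>M\<^esub>\<rbrakk> \<Longrightarrow>
      a = \<zero>\<^bsub>R\<^esub> \<or> m = \<zero>\<^bsub>M\<^esub>"
    and m: "\<And>i. m i \<in> carrier M" and f: "\<And>i. f i \<in> carrier R"
    and zero: "\<And>k. poly_ract M m f k = \<zero>\<^bsub>M\<^esub>"
  shows "(\<forall>i. m i = \<zero>\<^bsub>M\<^esub>) \<or> (\<forall>j. f j = \<zero>\<^bsub>R\<^esub>)"
proof (rule ccontr)
  assume "\<not> ?thesis"
  then obtain i0 j0 where "m i0 \<noteq> \<zero>\<^bsub>M\<^esub>" "f j0 \<noteq> \<zero>\<^bsub>R\<^esub>" by blast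
  then obtain p q where p: "m p \<noteq> \<zero>\<^bsub>M\<^esub>" "\<And>i. i < p \<Longrightarrow> m i = \<zero>\<^bsub>M\<^esub>"
    and q: "f q \<noteq> \<zero>\<^bsub>R\<^esub>" "\<And>j. j < q \<Longrightarrow> f j = \<zero>\<^bsub>R\<^esub>"
    using exists_least_iff[of "\<lambda>i. m i \<noteq> \<zero>\<^bsub>M\<^esub>"] exists_least_iff[of "\<lambda>j. f j \<noteq> \<zero>\<^bsub>R\<^esub>"] by metis
  \<comment> \<open>In degree \<open>p + q\<close> only \<open>i = p\<close> contributes: for
    \<open>i < p\<close> the factor \<open>m i\<close> is zero, and for \<open>i > p\<close> the
    index \<open>p + q - i\<close> lies below \<open>q\<close>. The conditional has the shape that
    \<open>finsum_singleton\<close> expects.\<close>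
  have "f (p + q - i) \<odot>\<^bsub>M\<^esub> m i = (if p = i then f q \<odot>\<^bsub>M\<^esub> m i else \<zero>\<^bsub>M\<^esub>)"
    if "i \<le> p + q" for i
  proof (cases i p rule: linorder_cases)
    case greater
    then show ?thesis using q(2)[of "p + q - i"] m that by simp
  qed (use m f p in auto)
  then have "poly_ract M m f (p + q) =
      (\<Oplus>\<^bsub>M\<^esub>i\<in>{..p + q}. if p = i then f q \<odot>\<^bsub>M\<^esub> m i else \<zero>\<^bsub>M\<^esub>)"
    unfolding poly_ract_def
    by (intro M.finsum_cong') (use m f in \<open>auto simp: ract_closed\<close>)
  also have "\<dots> = f q \<odot>\<^bsub>M\<^esub> m p"
    by (rule M.finsum_singleton) (use m f in \<open>auto simp: ract_closed\<close>)
  finally show False using zero ann m f p q by metis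
qed

end

locale nagata_extension = right_module R M + R: cring R + S: ring_hom_ring R R \<sigma>
  for R (structure) and M (structure) and \<sigma>
begin

lemma nagata_simps [simp]:
  "carrier (nagata R \<sigma> M) = carrier R \<times> carrier M"
  "\<zero>\<^bsub>nagata R \<sigma> M\<^esub> = (\<zero>\<^bsub>R\<^esub>, \<zero>\<^bsub>M\<^esub>)"
  "(a, m) \<oplus>\<^bsub>nagata R \<sigma> M\<^esub> (b, n) = (a \<oplus>\<^bsub>R\<^esub> b, m \<oplus>\<^bsub>M\<^esub> n)"
  by (simp_all add: nagata_def)

text \<open>Projections instead of pair patterns let this rewrite products of coefficients such as
  \<open>F i\<close>, which are not syntactically pairs.\<close>

lemma nagata_mult:
  "u \<otimes>\<^bsub>nagata R \<sigma> M\<^esub> v =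
     (fst u \<otimes>\<^bsub>R\<^esub> fst v, \<sigma> (fst u) \<odot>\<^bsub>M\<^esub> snd v \<oplus>\<^bsub>M\<^esub> fst v \<odot>\<^bsub>M\<^esub> snd u)"
  by (simp add: nagata_def case_prod_unfold)

sublocale N: ring "nagata R \<sigma> M"
  by (rule ring_nagata) (simp_all add: R.is_cring right_module_axioms S.homh)

lemma finsum_nagata:
  assumes "finite A" "\<And>i. i \<in> A \<Longrightarrow> a i \<in> carrier R" "\<And>i. i \<in> A \<Longrightarrow> m i \<in> carrier M"
  shows "(\<Oplus>\<^bsub>nagata R \<sigma> M\<^esub>i\<in>A. (a i, m i)) = (\<Oplus>\<^bsub>R\<^esub>i\<in>A. a i, \<Oplus>\<^bsub>M\<^esub>i\<in>A. m i)"
  using assms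
proof (induction A rule: finite_induct)
  case (insert x A)
  then show ?case
    by (simp add: N.finsum_insert R.finsum_insert M.finsum_insert Pi_def)
qed auto

text \<open>Sums are coordinatewise by \<open>finsum_nagata\<close>, so each coordinate is a
  convolution. In the twisted summand the vector comes from the right factor \<open>G\<close>, hence
  its index runs opposite to the one in \<open>poly_ract\<close> and has to be reversed.\<close>

lemma poly_ract_nagata:
  assumes F: "\<And>i. F i \<in> carrier (nagata R \<sigma> M)" and G: "\<And>i. G i \<in> carrier (nagata R \<sigma> M)"
  shows "poly_ract (regular_module (nagata R \<sigma> M)) F G k =
    (poly_ract (regular_module R) (\<lambda>i. fst (F i)) (\<lambda>i. fst (G i)) k,
     poly_ract M (\<lambda>i. snd (G i)) (\<lambda>i. \<sigma> (fst (F i))) k \<oplus>\<^bsub>M\<^esub>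
     poly_ract M (\<lambda>i. snd (F i)) (\<lambda>i. fst (G i)) k)"
proof -
  have F': "fst (F i) \<in> carrier R" "snd (F i) \<in> carrier M"
    and G': "fst (G i) \<in> carrier R" "snd (G i) \<in> carrier M" for i
    using F[of i] G[of i] by (auto simp: mem_Times_iff)
  have inj: "inj_on (\<lambda>i. k - i) {..k}" by (auto intro!: inj_onI)
  have img: "(\<lambda>i. k - i) ` {..k} = {..k}"
    by (auto simp: image_iff) (metis atMost_iff diff_diff_cancel diff_le_self)
  \<comment> \<open>Since \<open>i \<le> k\<close>, \<open>i\<close> equals
    \<open>k - (k - i)\<close>. The summand thereby becomes a function of \<open>k - i\<close>,
    ready for reindexing along this permutation of \<open>{..k}\<close>.\<close>
  have "(\<Oplus>\<^bsub>M\<^esub>i\<in>{..k}. \<sigma> (fst (F i)) \<odot>\<^bsub>M\<^esub> snd (G (k - i))) =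
      (\<Oplus>\<^bsub>M\<^esub>i\<in>{..k}. \<sigma> (fst (F (k - (k - i)))) \<odot>\<^bsub>M\<^esub> snd (G (k - i)))"
    by (intro M.finsum_cong') (auto simp: F' G' ract_closed)
  also have "\<dots> = poly_ract M (\<lambda>i. snd (G i)) (\<lambda>i. \<sigma> (fst (F i))) k"
    using M.finsum_reindex[OF _ inj,
        of "\<lambda>i. \<sigma> (fst (F (k - i))) \<odot>\<^bsub>M\<^esub> snd (G i)"]
    by (simp add: img poly_ract_def F' G' ract_closed)
  finally have reindex: "(\<Oplus>\<^bsub>M\<^esub>i\<in>{..k}. \<sigma> (fst (F i)) \<odot>\<^bsub>M\<^esub> snd (G (k - i))) = \<dots>" .
  have "poly_ract (regular_module (nagata R \<sigma> M)) F G k =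
      (\<Oplus>\<^bsub>R\<^esub>i\<in>{..k}. fst (F i) \<otimes>\<^bsub>R\<^esub> fst (G (k - i)),
       \<Oplus>\<^bsub>M\<^esub>i\<in>{..k}. \<sigma> (fst (F i)) \<odot>\<^bsub>M\<^esub> snd (G (k - i)) \<oplus>\<^bsub>M\<^esub>
         fst (G (k - i)) \<odot>\<^bsub>M\<^esub> snd (F i))"
    unfolding poly_ract_def
    by (simp add: nagata_mult, rule finsum_nagata) (auto simp: F' G' ract_closed)
  also have "(\<Oplus>\<^bsub>M\<^esub>i\<in>{..k}. \<sigma> (fst (F i)) \<odot>\<^bsub>M\<^esub> snd (G (k - i)) \<oplus>\<^bsub>M\<^esub>
         fst (G (k - i)) \<odot>\<^bsub>M\<^esub> snd (F i)) =
      poly_ract M (\<lambda>i. snd (G i)) (\<lambda>i. \<sigma> (fst (F i))) k \<oplus>\<^bsub>M\<^esub>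
      poly_ract M (\<lambda>i. snd (F i)) (\<lambda>i. fst (G i)) k"
    by (subst M.finsum_addf)
       (auto simp: F' G' ract_closed reindex poly_ract_def[of M "\<lambda>i. snd (F i)"])
  finally show ?thesis by (simp add: poly_ract_def[of "regular_module R"])
qed

lemma armendariz_module_if_armendariz_nagata:
  assumes "armendariz_ring (nagata R \<sigma> M)"
  shows "armendariz_module R M"
  unfolding armendariz_module_def
proof (intro conjI ballI impI allI right_module_axioms)
  fix m f i j
  assume m: "m \<in> up M" and f: "f \<in> up R" and zero: "poly_ract M m f = (\<lambda>k. \<zero>\<^bsub>M\<^esub>)"
  note mf = up_closed[OF m] up_closed[OF f]
  let ?F = "\<lambda>i. (\<zero>\<^bsub>R\<^esub>, m i)" and ?G = "\<lambda>i. (f i, \<zero>\<^bsub>M\<^esub>)"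
  have FG: "?F \<in> up (nagata R \<sigma> M)" "?G \<in> up (nagata R \<sigma> M)"
    by (rule up_map[OF m] up_map[OF f]; simp)+
  interpret Reg: right_module R "regular_module R"
    by (simp add: right_module_regular_iff R.ring_axioms)
  have "poly_ract (regular_module R) (\<lambda>i. \<zero>\<^bsub>R\<^esub>) f k = \<zero>\<^bsub>R\<^esub>" for k
    using Reg.poly_ract_zero_left[of "\<lambda>i. \<zero>\<^bsub>R\<^esub>" f k] mf by simp
  \<comment> \<open>The scalar coordinate vanishes because \<open>?F\<close> has zero scalars, the
    twisted summand because \<open>?G\<close> has zero vectors; only the product of \<open>m\<close>
    and \<open>f\<close> remains.\<close>
  then have "poly_ract (regular_module (nagata R \<sigma> M)) ?F ?G = (\<lambda>k. (\<zero>\<^bsub>R\<^esub>, \<zero>\<^bsub>M\<^esub>))"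
    using mf by (auto simp: poly_ract_nagata poly_ract_zero_left zero)
  then have "?G j \<odot>\<^bsub>regular_module (nagata R \<sigma> M)\<^esub> ?F i = (\<zero>\<^bsub>R\<^esub>, \<zero>\<^bsub>M\<^esub>)"
    using assms FG by (force simp: armendariz_ring_def armendariz_module_def)
  then show "f j \<odot>\<^bsub>M\<^esub> m i = \<zero>\<^bsub>M\<^esub>"
    using mf by (simp add: nagata_mult ract_closed)
qed

lemma armendariz_nagata_if_armendariz_module:
  assumes dom: "domain R" and arm: "armendariz_module R M"
  shows "armendariz_ring (nagata R \<sigma> M)"
  unfolding armendariz_ring_def armendariz_module_def
proof (intro conjI ballI impI allI)
  show "right_module (nagata R \<sigma> M) (regular_module (nagata R \<sigma> M))"
    by (simp add: right_module_regular_iff N.ring_axioms)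
next
  have armD: "f j \<odot>\<^bsub>M\<^esub> m i = \<zero>\<^bsub>M\<^esub>"
    if "m \<in> up M" "f \<in> up R" "\<And>k. poly_ract M m f k = \<zero>\<^bsub>M\<^esub>" for m f i j
    using arm that unfolding armendariz_module_def by fast
  interpret Reg: right_module R "regular_module R"
    by (simp add: right_module_regular_iff R.ring_axioms)
  fix F G i j
  assume "F \<in> up (regular_module (nagata R \<sigma> M))" "G \<in> up (nagata R \<sigma> M)"
    and zero: "poly_ract (regular_module (nagata R \<sigma> M)) F G =
      (\<lambda>k. \<zero>\<^bsub>regular_module (nagata R \<sigma> M)\<^esub>)"
  then have F: "F \<in> up (nagata R \<sigma> M)" and G: "G \<in> up (nagata R \<sigma> M)" by simp_all
  note FG = up_closed[OF F] up_closed[OF G]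
  have FG': "fst (F i) \<in> carrier R" "snd (F i) \<in> carrier M"
    "fst (G i) \<in> carrier R" "snd (G i) \<in> carrier M" for i
    using FG[of i] by (auto simp: mem_Times_iff)
  have up: "(\<lambda>i. snd (F i)) \<in> up M" "(\<lambda>i. snd (G i)) \<in> up M"
    "(\<lambda>i. fst (G i)) \<in> up R" "(\<lambda>i. \<sigma> (fst (F i))) \<in> up R"
    by (rule up_map[OF F] up_map[OF G]; auto)+
  \<comment> \<open>The carrier of the extension must stay folded during simplification, since
    \<open>FG\<close> discharges the premises of \<open>poly_ract_nagata\<close> in that
    form.\<close>
  have zeros: "poly_ract (regular_module R) (\<lambda>i. fst (F i)) (\<lambda>i. fst (G i)) k = \<zero>\<^bsub>R\<^esub>"
    "poly_ract M (\<lambda>i. snd (G i)) (\<lambda>i. \<sigma> (fst (F i))) k \<oplus>\<^bsub>M\<^esub>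
     poly_ract M (\<lambda>i. snd (F i)) (\<lambda>i. fst (G i)) k = \<zero>\<^bsub>M\<^esub>" for k
    using fun_cong[OF zero, of k] by (simp_all add: poly_ract_nagata FG del: nagata_simps(1))
  \<comment> \<open>Applied to \<open>R\<close> as a module over itself, the lowest-coefficient
    argument says that \<open>R[x]\<close> has no zero divisors.\<close>
  have "(\<forall>i. fst (F i) = \<zero>\<^bsub>R\<^esub>) \<or> (\<forall>j. fst (G j) = \<zero>\<^bsub>R\<^esub>)"
    using Reg.poly_ract_eq_zero_imp[of "\<lambda>i. fst (F i)" "\<lambda>i. fst (G i)"] zeros(1) FG'
      domain.integral[OF dom] unfolding regular_module_simps by blast
  \<comment> \<open>By \<open>nagata_mult\<close> these are the ingredients of the product of
    \<open>F i\<close> and \<open>G j\<close>; the two summands of its second coordinate vanish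
    separately.\<close>
  then have "\<sigma> (fst (F i)) \<odot>\<^bsub>M\<^esub> snd (G j) = \<zero>\<^bsub>M\<^esub> \<and> fst (G j) \<odot>\<^bsub>M\<^esub> snd (F i) = \<zero>\<^bsub>M\<^esub> \<and>
      fst (F i) \<otimes>\<^bsub>R\<^esub> fst (G j) = \<zero>\<^bsub>R\<^esub>"
  proof
    \<comment> \<open>Here \<open>\<sigma> \<zero> = \<zero>\<close> kills the twisted summand, so
      the Armendariz property applies to the vectors of \<open>F\<close> and the scalars of
      \<open>G\<close>.\<close>
    assume f: "\<forall>i. fst (F i) = \<zero>\<^bsub>R\<^esub>"
    then have "poly_ract M (\<lambda>i. snd (F i)) (\<lambda>i. fst (G i)) k = \<zero>\<^bsub>M\<^esub>" for k
      using zeros(2)[of k] by (simp add: poly_ract_zero_right poly_ract_closed FG')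
    then show ?thesis using armD[OF up(1,3)] f by (simp add: FG')
  next
    \<comment> \<open>Now the untwisted summand is zero, and the Armendariz property applies to the
      vectors of \<open>G\<close> and the \<open>\<sigma>\<close>-images of the scalars of
      \<open>F\<close>.\<close>
    assume g: "\<forall>j. fst (G j) = \<zero>\<^bsub>R\<^esub>"
    then have "poly_ract M (\<lambda>i. snd (G i)) (\<lambda>i. \<sigma> (fst (F i))) k = \<zero>\<^bsub>M\<^esub>" for k
      using zeros(2)[of k] by (simp add: poly_ract_zero_right poly_ract_closed FG')
    then show ?thesis using armD[OF up(2,4)] g by (simp add: FG')
  qed
  then show "G j \<odot>\<^bsub>regular_module (nagata R \<sigma> M)\<^esub> F i = \<zero>\<^bsub>regular_module (nagata R \<sigma> M)\<^esub>"
    by (simp add: nagata_mult)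
qed

end

text \<open>Without torsion, a zero product of a polynomial over \<open>M\<close> and one over
  \<open>R\<close> forces one factor to be zero, so all coefficient products vanish
  trivially.\<close>

lemma (in right_module) armendariz_if_torsion_free:
  assumes "torsion_free R M"
  shows "armendariz_module R M"
  unfolding armendariz_module_def
proof (intro conjI ballI impI allI right_module_axioms)
  fix m f i j
  assume m: "m \<in> up M" and f: "f \<in> up R" and zero: "poly_ract M m f = (\<lambda>k. \<zero>\<^bsub>M\<^esub>)"
  \<comment> \<open>A nonzero \<open>n\<close> lies outside \<open>torsion_set R M\<close>, so its
    annihilator is the zero ideal.\<close>
  have "a = \<zero>\<^bsub>R\<^esub> \<or> n = \<zero>\<^bsub>M\<^esub>"
    if "a \<in> carrier R" "n \<in> carrier M" "a \<odot>\<^bsub>M\<^esub> n = \<zero>\<^bsub>M\<^esub>" for a n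
    using assms that unfolding torsion_free_def torsion_set_def right_annihilator_def by blast
  then have "(\<forall>i. m i = \<zero>\<^bsub>M\<^esub>) \<or> (\<forall>j. f j = \<zero>\<^bsub>R\<^esub>)"
    by (rule poly_ract_eq_zero_imp) (use zero m f in \<open>simp_all add: up_closed\<close>)
  then show "f j \<odot>\<^bsub>M\<^esub> m i = \<zero>\<^bsub>M\<^esub>"
    using up_closed[OF m] up_closed[OF f] by auto
qed

theorem proposition3p1:
  fixes R :: "('a, 'r) ring_scheme"
    and M :: "('a, 'b, 'm) module_scheme"
    and \<sigma> :: "'a \<Rightarrow> 'a"
  assumes "domain R"
    and "\<sigma> \<in> ring_hom R R"
    and "right_module R M"
  shows "(armendariz_ring (nagata R \<sigma> M) \<longleftrightarrow> armendariz_module R M) \<and>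
         (torsion_free R M \<longrightarrow> armendariz_ring (nagata R \<sigma> M))"
proof -
  interpret R: domain R by fact
  interpret right_module R M by fact
  interpret nagata_extension R M \<sigma>
    by (intro nagata_extension.intro ring_hom_ringI2)
       (simp_all add: assms R.is_cring R.ring_axioms)
  show ?thesis
    using armendariz_module_if_armendariz_nagata armendariz_nagata_if_armendariz_module
      armendariz_if_torsion_free assms(1) by blast
qed

end
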